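(* Let $\Omega\subset\mathbb{R}^d$ ($d\in\{1,2,3\}$) be a bounded domain, let $0<\alpha<1$, $T>0$, and let $M_1,M_2,f_1,f_2:\mathbb{R}^2\to\mathbb{R}$ satisfy: (H1) there are constants $0<m_1\le m_2$ with $m_1\le M_i(x,y)\le m_2$ for all $x,y\in\mathbb{R}$, $i=1,2$; (H2) each $M_i$ is Lipschitz: $|M_i(x_1,y_1)-M_i(x_2,y_2)|\le L_i'|x_1-x_2|+K_i'|y_1-y_2|$; (H3) each $f_i$ is Lipschitz: $|f_i(x_1,y_1)-f_i(x_2,y_2)|\le L_i|x_1-x_2|+K_i|y_1-y_2|$. Let $X_h$, $\tau=T/N$, $t_n=n\tau$, $D^\alpha_\tau$, $U^{n,\alpha}$, $V^{n,\alpha}$ and $l(\cdot)$ be as in the context, and let $U^n,V^n\in X_h$, $1\le n\le N$, be a solution of the fully discrete scheme: $U^0=V^0=0$ and for each $n=1,\dots,N$, $$(D^\alpha_\tau U^n,w)+M_1\big(l(U^{n,\alpha}),l(V^{n,\alpha})\big)(\nabla U^{n,\alpha},\nabla w)=(f_1(U^{n,\alpha},V^{n,\alpha}),w)\quad\forall w\in X_h,$$ $$(D^\alpha_\tau V^n,\omega)+M_2\big(l(U^{n,\alpha}),l(V^{n,\alpha})\big)(\nabla V^{n,\alpha},\nabla \omega)=(f_2(U^{n,\alpha},V^{n,\alpha}),\omega)\quad\forall \omega\in X_h.$$ Then there exists a constant $\tau^*>0$, independent of $h$, such that whenever $\tau\le\tau^*$, $$\|U^n\|+\|V^n\|\le C\quad\text{and}\quad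 \|\nabla U^n\|+\|\nabla V^n\|\le C,\qquad 1\le n\le N,$$ where $C>0$ is a constant independent of $h$ and $\tau$.
   Context: $(\cdot,\cdot)$ and $\|\cdot\|$ denote the inner product and norm of $L^2(\Omega)$. $\Omega_h$ is a quasi-uniform partition of $\Omega$ into intervals (for $d=1$) or triangles with mesh size $h$, and $X_h=\{w\in C^0(\bar\Omega): w|_{T_k}\in P_1(T_k)\ \forall T_k\in\Omega_h,\ w=0 \text{ on }\partial\Omega\}\subset H^1_0(\Omega)$ (continuous piecewise linear finite elements). Time step $\tau=T/N$, $t_n=n\tau$. For a sequence $\phi^0,\phi^1,\dots$, the fractional Crank–Nicolson approximation of the Caputo derivative is $D^\alpha_\tau\phi^n=\tau^{-\alpha}\sum_{j=0}^n b_{n-j}\phi^j$ with $b_k=(-1)^k\frac{\Gamma(\alpha+1)}{\Gamma(k+1)\Gamma(\alpha-k+1)}$. Also $U^{n,\alpha}=(1-\frac{\alpha}{2})U^n+\frac{\alpha}{2}U^{n-1}$, $V^{n,\alpha}=(1-\frac{\alpha}{2})V^n+\frac{\alpha}{2}V^{n-1}$, $l(w)=\int_\Omega w\,dx$, and $f_i(U,V)$ denotes the pointwise composition $x\mapsto f_i(U(x),V(x))$. *)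

theory Defs
  imports "HOL-Analysis.Analysis"
begin

definition is_simplex :: "'a::euclidean_space set \<Rightarrow> bool" where
  "is_simplex K \<longleftrightarrow> (\<exists>P. finite P \<and> card P = DIM('a) + 1 \<and> \<not> affine_dependent P \<and> K = convex hull P)"

definition mesh_size :: "'a::euclidean_space set set \<Rightarrow> real" where
  "mesh_size Th = Max (diameter ` Th)"

definition quasi_uniform_mesh :: "real \<Rightarrow> 'a::euclidean_space set \<Rightarrow> 'a set set \<Rightarrow> bool" where
  "quasi_uniform_mesh \<sigma> \<Omega> Th \<longleftrightarrow>
     finite Th \<and> Th \<noteq> {} \<and> (\<forall>K\<in>Th. is_simplex K) \<and>
     \<Union>Th = closure \<Omega> \<and>
     (\<forall>K1\<in>Th. \<forall>K2\<in>Th. K1 \<noteq> K2 \<longrightarrow> interior K1 \<inter> interior K2 = {}) \<and>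
     (\<forall>K1\<in>Th. \<forall>K2\<in>Th. (K1 \<inter> K2) face_of K1 \<and> (K1 \<inter> K2) face_of K2) \<and>
     (\<forall>K\<in>Th. \<exists>c. ball c (\<sigma> * mesh_size Th) \<subseteq> K)"

text \<open>Continuous piecewise linear finite element space X_h with zero boundary
  values (functions are extended by zero outside Omega).\<close>
definition Xh :: "'a::euclidean_space set \<Rightarrow> 'a set set \<Rightarrow> ('a \<Rightarrow> real) set" where
  "Xh \<Omega> Th = {w. continuous_on UNIV w \<and> (\<forall>x. x \<notin> \<Omega> \<longrightarrow> w x = 0) \<and>
      (\<forall>K\<in>Th. \<exists>c b. \<forall>x\<in>K. w x = c \<bullet> x + b)}"

text \<open>Gradient (defined almost everywhere for piecewise linear functions).\<close>
definition grad :: "('a::euclidean_space \<Rightarrow> real) \<Rightarrow> 'a \<Rightarrow> 'a" where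
  "grad u x = (\<Sum>b\<in>Basis. frechet_derivative u (at x) b *\<^sub>R b)"

definition L2_inner :: "'a::euclidean_space set \<Rightarrow> ('a \<Rightarrow> real) \<Rightarrow> ('a \<Rightarrow> real) \<Rightarrow> real" where
  "L2_inner \<Omega> u v = integral \<Omega> (\<lambda>x. u x * v x)"

definition L2_norm :: "'a::euclidean_space set \<Rightarrow> ('a \<Rightarrow> real) \<Rightarrow> real" where
  "L2_norm \<Omega> u = sqrt (integral \<Omega> (\<lambda>x. (u x)\<^sup>2))"

definition grad_inner :: "'a::euclidean_space set \<Rightarrow> ('a \<Rightarrow> real) \<Rightarrow> ('a \<Rightarrow> real) \<Rightarrow> real" where
  "grad_inner \<Omega> u v = integral \<Omega> (\<lambda>x. grad u x \<bullet> grad v x)"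

definition grad_norm :: "'a::euclidean_space set \<Rightarrow> ('a \<Rightarrow> real) \<Rightarrow> real" where
  "grad_norm \<Omega> u = sqrt (integral \<Omega> (\<lambda>x. (norm (grad u x))\<^sup>2))"

definition lfun :: "'a::euclidean_space set \<Rightarrow> ('a \<Rightarrow> real) \<Rightarrow> real" where
  "lfun \<Omega> w = integral \<Omega> w"

definition bw :: "real \<Rightarrow> nat \<Rightarrow> real" where
  "bw \<alpha> k = (-1) ^ k * Gamma (\<alpha> + 1) / (Gamma (real k + 1) * Gamma (\<alpha> - real k + 1))"

definition Dfrac :: "real \<Rightarrow> real \<Rightarrow> (nat \<Rightarrow> 'a \<Rightarrow> real) \<Rightarrow> nat \<Rightarrow> 'a \<Rightarrow> real" where
  "Dfrac \<alpha> \<tau> \<phi> n x = \<tau> powr (- \<alpha>) * (\<Sum>j=0..n. bw \<alpha> (n - j) * \<phi> j x)"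

definition shiftw :: "real \<Rightarrow> (nat \<Rightarrow> 'a \<Rightarrow> real) \<Rightarrow> nat \<Rightarrow> 'a \<Rightarrow> real" where
  "shiftw \<alpha> \<phi> n x = (1 - \<alpha> / 2) * \<phi> n x + (\<alpha> / 2) * \<phi> (n - 1) x"

definition solves_scheme ::
  "'a::euclidean_space set \<Rightarrow> 'a set set \<Rightarrow> real \<Rightarrow> real \<Rightarrow> nat \<Rightarrow>
   (real \<Rightarrow> real \<Rightarrow> real) \<Rightarrow> (real \<Rightarrow> real \<Rightarrow> real) \<Rightarrow>
   (real \<Rightarrow> real \<Rightarrow> real) \<Rightarrow> (real \<Rightarrow> real \<Rightarrow> real) \<Rightarrow>
   (nat \<Rightarrow> 'a \<Rightarrow> real) \<Rightarrow> (nat \<Rightarrow> 'a \<Rightarrow> real) \<Rightarrow> bool" where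
  "solves_scheme \<Omega> Th \<alpha> T N M1 M2 f1 f2 U V \<longleftrightarrow>
     (let \<tau> = T / real N in
     (\<forall>n\<le>N. U n \<in> Xh \<Omega> Th \<and> V n \<in> Xh \<Omega> Th) \<and>
     U 0 = (\<lambda>x. 0) \<and> V 0 = (\<lambda>x. 0) \<and>
     (\<forall>n\<in>{1..N}. \<forall>w\<in>Xh \<Omega> Th.
        L2_inner \<Omega> (Dfrac \<alpha> \<tau> U n) w
        + M1 (lfun \<Omega> (shiftw \<alpha> U n)) (lfun \<Omega> (shiftw \<alpha> V n)) * grad_inner \<Omega> (shiftw \<alpha> U n) w
        = L2_inner \<Omega> (\<lambda>x. f1 (shiftw \<alpha> U n x) (shiftw \<alpha> V n x)) w) \<and>
     (\<forall>n\<in>{1..N}. \<forall>w\<in>Xh \<Omega> Th.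
        L2_inner \<Omega> (Dfrac \<alpha> \<tau> V n) w
        + M2 (lfun \<Omega> (shiftw \<alpha> U n)) (lfun \<Omega> (shiftw \<alpha> V n)) * grad_inner \<Omega> (shiftw \<alpha> V n) w
        = L2_inner \<Omega> (\<lambda>x. f2 (shiftw \<alpha> U n x) (shiftw \<alpha> V n x)) w))"

end

theory Submission
  imports Defs
begin

text \<open>
  Testing the scheme with \<open>U\<^sup>n\<^sup>,\<^sup>\<alpha>\<close> and with \<open>D\<^sub>\<tau>\<^sup>\<alpha> U\<^sup>n\<close> (dividing by \<open>M\<^sub>i \<ge> m\<^sub>1\<close> in the second case) leaves
  the terms \<open>(D\<^sub>\<tau>\<^sup>\<alpha> U\<^sup>n, U\<^sup>n\<^sup>,\<^sup>\<alpha>)\<close> and \<open>(\<nabla> D\<^sub>\<tau>\<^sup>\<alpha> U\<^sup>n, \<nabla> U\<^sup>n\<^sup>,\<^sup>\<alpha>)\<close>. Both are bounded below by the pointwise inequality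
  \<open>(D\<^sub>\<tau>\<^sup>\<alpha> \<phi>\<^sup>n) \<bullet> \<phi>\<^sup>n\<^sup>,\<^sup>\<alpha> \<ge> (1/2) D\<^sub>\<tau>\<^sup>\<alpha> |\<phi>\<^sup>n|\<^sup>2\<close>, so \<open>y\<^sub>n = \<parallel>U\<^sup>n\<parallel>\<^sup>2 + \<parallel>V\<^sup>n\<parallel>\<^sup>2\<close> satisfies
  \<open>D\<^sub>\<tau>\<^sup>\<alpha> y\<^sub>n \<le> \<lambda> (y\<^sub>n + y\<^sub>n\<^sub>-\<^sub>1) + \<mu>\<close>, and the gradient norms satisfy the same with \<open>\<lambda> = 0\<close> once \<open>y\<close> is
  bounded. An exponential \<open>exp (\<beta> t\<^sub>n)\<close> is a supersolution of this recursion when \<open>\<beta>\<close> is large and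
  \<open>\<beta> \<tau> \<le> 1\<close>, because the generating function of the weights is \<open>(1 - q)\<^sup>\<alpha>\<close>.
\<close>

section \<open>The convolution weights\<close>

text \<open>Links the Gamma quotient to generalized binomial coefficients, whose recurrence and
  power series yield all later properties of the weights.\<close>

lemma bw_gbinomial:
  assumes "0 < \<alpha>"
  shows "bw \<alpha> k = (-1) ^ k * (\<alpha> gchoose k)"
proof -
  have "\<alpha> + 1 \<notin> \<int>\<^sub>\<le>\<^sub>0"
    using assms nonpos_Ints_nonpos by force
  moreover have "Gamma (real k + 1) = fact k"
    using Gamma_fact[of k, where 'a = real] by (simp add: add.commute)
  ultimately show ?thesis
    by (simp add: bw_def gbinomial_Gamma)
qed

lemma bw_0: "0 < \<alpha> \<Longrightarrow> bw \<alpha> 0 = 1"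
  by (simp add: bw_gbinomial)

lemma bw_Suc:
  assumes "0 < \<alpha>"
  shows "(real k + 1) * bw \<alpha> (Suc k) = (real k - \<alpha>) * bw \<alpha> k"
proof -
  have "(real k + 1) * (\<alpha> gchoose Suc k) = (\<alpha> - real k) * (\<alpha> gchoose k)"
    using gbinomial_mult_1[of \<alpha> k] by (simp add: algebra_simps)
  then have "- ((-1) ^ k) * ((real k + 1) * (\<alpha> gchoose Suc k)) = - ((-1) ^ k) * ((\<alpha> - real k) * (\<alpha> gchoose k))"
    by simp
  then show ?thesis
    using assms by (simp add: bw_gbinomial algebra_simps)
qed

lemma bw_1: "0 < \<alpha> \<Longrightarrow> bw \<alpha> 1 = - \<alpha>"
  using bw_Suc[of \<alpha> 0] by (simp add: bw_0)

text \<open>For \<open>k \<ge> 1\<close> the factor \<open>real k - \<alpha>\<close> in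
  \<open>bw_Suc\<close> is positive, so the recurrence carries the sign of
  \<open>bw \<alpha> 1 = - \<alpha>\<close> to all later weights.\<close>

lemma bw_nonpos:
  assumes "0 < \<alpha>" "\<alpha> < 1" "1 \<le> k"
  shows "bw \<alpha> k \<le> 0"
  using assms(3)
proof (induction k rule: dec_induct)
  case base
  then show ?case using bw_1 assms by simp
next
  case (step k)
  have "(real k + 1) * bw \<alpha> (Suc k) \<le> 0"
    unfolding bw_Suc[OF assms(1)] using step assms by (intro mult_nonneg_nonpos) auto
  then show ?case by (simp add: mult_le_0_iff)
qed

text \<open>The recurrence lets the partial sums telescope: \<alpha> times the sum is
  \<open>- (real n + 1) * bw \<alpha> (Suc n)\<close>, and \<open>bw_nonpos\<close> gives the
  sign.\<close>

lemma sum_bw_nonneg: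
  assumes "0 < \<alpha>" "\<alpha> < 1"
  shows "0 \<le> (\<Sum>k=0..n. bw \<alpha> k)"
proof -
  have "\<alpha> * (\<Sum>k=0..n. bw \<alpha> k) = - (real n + 1) * bw \<alpha> (Suc n)"
  proof (induction n)
    case 0
    then show ?case using assms by (simp add: bw_0 bw_1[simplified])
  next
    case (Suc n)
    have "\<alpha> * (\<Sum>k=0..Suc n. bw \<alpha> k) = - ((real (Suc n) - \<alpha>) * bw \<alpha> (Suc n))"
      using Suc by (simp add: algebra_simps)
    then show ?case
      using bw_Suc[OF assms(1), of "Suc n"] by (metis minus_mult_left)
  qed
  moreover have "0 \<le> - (real n + 1) * bw \<alpha> (Suc n)"
    using bw_nonpos[OF assms, of "Suc n"] by (simp add: mult_nonpos_nonpos)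
  ultimately have "0 \<le> \<alpha> * (\<Sum>k=0..n. bw \<alpha> k)"
    by argo
  then show ?thesis
    using assms by (simp add: zero_le_mult_iff)
qed

text \<open>The left-hand side is the full binomial series, whose tail has only nonpositive terms.\<close>
lemma sum_bw_power_ge:
  assumes "0 < \<alpha>" "\<alpha> < 1" "0 < q" "q < 1"
  shows "(1 - q) powr \<alpha> \<le> (\<Sum>k=0..n. bw \<alpha> k * q ^ k)"
proof -
  have "(\<lambda>k. (\<alpha> gchoose k) * (- q) ^ k) sums (1 + - q) powr \<alpha>"
    using assms by (intro gen_binomial_real) auto
  moreover have "(\<alpha> gchoose k) * (- q) ^ k = bw \<alpha> k * q ^ k" for k
    using assms(1) by (simp add: bw_gbinomial power_minus[of q])
  ultimately have s: "(\<lambda>k. bw \<alpha> k * q ^ k) sums (1 - q) powr \<alpha>"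
    by simp
  have "(\<lambda>k. - (bw \<alpha> k * q ^ k)) sums (- ((1 - q) powr \<alpha>))"
    using s by (rule sums_minus)
  moreover have "0 \<le> - (bw \<alpha> k * q ^ k)" if "k \<notin> {0..n}" for k
    using that bw_nonpos[OF assms(1,2), of k] assms(3) by (simp add: mult_nonpos_nonneg)
  ultimately have "(\<Sum>k=0..n. - (bw \<alpha> k * q ^ k)) \<le> - ((1 - q) powr \<alpha>)"
    using sum_le_suminf[of "\<lambda>k. - (bw \<alpha> k * q ^ k)" "{0..n}"] by (simp add: sums_iff)
  then show ?thesis by (simp add: sum_negf)
qed

section \<open>Discrete energy inequality and Gronwall bound\<close>

lemma sum_split_last:
  fixes n :: nat and g :: "nat \<Rightarrow> 'b::comm_monoid_add"
  shows "(\<Sum>j=0..n. g j) = g n + (\<Sum>j<n. g j)"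
  by (simp add: atLeast0AtMost lessThan_Suc_atMost[symmetric] add.commute)

text \<open>With \<open>s = (1 - \<alpha>/2) \<phi>\<^sub>n + (\<alpha>/2) \<phi>\<^sub>n\<^sub>-\<^sub>1\<close>, \<open>a\<^sub>j = - b\<^sub>n\<^sub>-\<^sub>j\<close> and
  \<open>r = \<Sum>\<^sub>k\<^sub>\<le>\<^sub>n b\<^sub>k\<close>, twice the difference of the two sides equals
  \<open>\<Sum>\<^sub>j\<^sub><\<^sub>n a\<^sub>j |s - \<phi>\<^sub>j|\<^sup>2 + r |s|\<^sup>2 - |s - \<phi>\<^sub>n|\<^sup>2\<close>,
  and the summand \<open>j = n - 1\<close> alone absorbs the negative term.\<close>
lemma bw_energy_inequality:
  fixes \<phi> :: "nat \<Rightarrow> 'b::real_inner"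
  assumes \<alpha>: "0 < \<alpha>" "\<alpha> < 1" and n: "1 \<le> n"
  shows "(\<Sum>j=0..n. bw \<alpha> (n - j) * (norm (\<phi> j))\<^sup>2) / 2
    \<le> (\<Sum>j=0..n. bw \<alpha> (n - j) *\<^sub>R \<phi> j) \<bullet> ((1 - \<alpha> / 2) *\<^sub>R \<phi> n + (\<alpha> / 2) *\<^sub>R \<phi> (n - 1))"
proof -
  define s where "s = (1 - \<alpha> / 2) *\<^sub>R \<phi> n + (\<alpha> / 2) *\<^sub>R \<phi> (n - 1)"
  define a where "a j = - bw \<alpha> (n - j)" for j
  define r where "r = (\<Sum>k=0..n. bw \<alpha> k)"
  define \<delta> where "\<delta> = \<phi> n - \<phi> (n - 1)"
  have r: "0 \<le> r" unfolding r_def by (rule sum_bw_nonneg[OF \<alpha>])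
  have a: "0 \<le> a j" if "j < n" for j
    unfolding a_def using bw_nonpos[OF \<alpha>, of "n - j"] that by simp
  have "(\<Sum>j=0..n. bw \<alpha> (n - j)) = r"
    unfolding r_def by (metis add.right_neutral diff_zero sum.atLeastAtMost_rev)
  then have ra: "r = 1 - (\<Sum>j<n. a j)"
    by (simp add: sum_split_last a_def bw_0[OF \<alpha>(1)] sum_negf)
  have sq: "(norm (s - \<phi> j))\<^sup>2 = (norm s)\<^sup>2 - 2 * (s \<bullet> \<phi> j) + (norm (\<phi> j))\<^sup>2" for j
    by (simp add: power2_norm_eq_inner inner_diff_left inner_diff_right inner_commute)
  have 1: "(\<Sum>j<n. a j * (norm (s - \<phi> j))\<^sup>2)
      = (\<Sum>j<n. a j) * (norm s)\<^sup>2 - 2 * (\<Sum>j<n. a j * (s \<bullet> \<phi> j)) + (\<Sum>j<n. a j * (norm (\<phi> j))\<^sup>2)"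
  proof -
    have "(\<Sum>j<n. a j * (norm (s - \<phi> j))\<^sup>2)
      = (\<Sum>j<n. a j * (norm s)\<^sup>2 - 2 * (a j * (s \<bullet> \<phi> j)) + a j * (norm (\<phi> j))\<^sup>2)"
      unfolding sq by (intro sum.cong) (simp_all add: algebra_simps)
    then show ?thesis
      by (simp add: sum.distrib sum_subtractf sum_distrib_left sum_distrib_right)
  qed
  have 2: "(\<Sum>j=0..n. bw \<alpha> (n - j) *\<^sub>R \<phi> j) \<bullet> s = s \<bullet> \<phi> n - (\<Sum>j<n. a j * (s \<bullet> \<phi> j))"
    by (simp add: sum_split_last a_def bw_0[OF \<alpha>(1)] sum_negf inner_commute[of _ s] inner_add_right inner_sum_right)
  have 3: "(\<Sum>j=0..n. bw \<alpha> (n - j) * (norm (\<phi> j))\<^sup>2) = (norm (\<phi> n))\<^sup>2 - (\<Sum>j<n. a j * (norm (\<phi> j))\<^sup>2)"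
    by (simp add: sum_split_last a_def bw_0[OF \<alpha>(1)] sum_negf)
  have id: "2 * ((\<Sum>j=0..n. bw \<alpha> (n - j) *\<^sub>R \<phi> j) \<bullet> s) - (\<Sum>j=0..n. bw \<alpha> (n - j) * (norm (\<phi> j))\<^sup>2)
     = (\<Sum>j<n. a j * (norm (s - \<phi> j))\<^sup>2) + r * (norm s)\<^sup>2 - (norm (s - \<phi> n))\<^sup>2"
  proof -
    have "r * (norm s)\<^sup>2 = (norm s)\<^sup>2 - (\<Sum>j<n. a j) * (norm s)\<^sup>2"
      unfolding ra by (simp add: left_diff_distrib)
    then show ?thesis
      using 1 2 3 sq[of n] by linarith
  qed
  have "s - \<phi> (n - 1) = (1 - \<alpha> / 2) *\<^sub>R \<delta>" "s - \<phi> n = (- \<alpha> / 2) *\<^sub>R \<delta>"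
    unfolding s_def \<delta>_def by (simp_all add: algebra_simps)
  then have d: "(norm (s - \<phi> (n - 1)))\<^sup>2 = (1 - \<alpha> / 2)\<^sup>2 * (norm \<delta>)\<^sup>2"
      "(norm (s - \<phi> n))\<^sup>2 = (\<alpha> / 2)\<^sup>2 * (norm \<delta>)\<^sup>2"
    by (simp_all add: power_mult_distrib power_divide)
  \<comment> \<open>This product is four times
    \<open>(1 - \<alpha> / 2)\<^sup>2 - \<alpha> / 4\<close>. Multiplied by
    \<open>\<alpha> = a (n - 1)\<close>, the resulting inequality compares the two coefficients of
    \<open>(norm \<delta>)\<^sup>2\<close>.\<close>
  have "0 \<le> (1 - \<alpha>) * (4 - \<alpha>)" using \<alpha> by simp
  then have "\<alpha> / 4 \<le> (1 - \<alpha> / 2)\<^sup>2"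
    by (simp add: power2_eq_square algebra_simps)
  then have "\<alpha> * (\<alpha> / 4) \<le> \<alpha> * (1 - \<alpha> / 2)\<^sup>2"
    using \<alpha> by (intro mult_left_mono) auto
  then have "(\<alpha> / 2)\<^sup>2 * (norm \<delta>)\<^sup>2 \<le> (\<alpha> * (1 - \<alpha> / 2)\<^sup>2) * (norm \<delta>)\<^sup>2"
    by (intro mult_right_mono) (auto simp: power2_eq_square)
  also have "\<dots> = a (n - 1) * (norm (s - \<phi> (n - 1)))\<^sup>2"
    unfolding d a_def using n bw_1[OF \<alpha>(1)] by simp
  also have "\<dots> \<le> (\<Sum>j<n. a j * (norm (s - \<phi> j))\<^sup>2)"
    using n a by (intro member_le_sum) auto
  finally have "0 \<le> (\<Sum>j<n. a j * (norm (s - \<phi> j))\<^sup>2) + r * (norm s)\<^sup>2 - (norm (s - \<phi> n))\<^sup>2"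
    using mult_nonneg_nonneg[OF r zero_le_power2[of "norm s"]] d(2) by linarith
  then show ?thesis
    using id unfolding s_def[symmetric] by linarith
qed

text \<open>Comparison with the supersolution \<open>e\<^sub>n = exp (\<beta> n \<tau>)\<close>: since \<open>b\<^sub>k \<le> 0\<close> for \<open>k \<ge> 1\<close>,
  \<open>e - y\<close> stays nonnegative.\<close>
lemma bw_gronwall:
  assumes \<alpha>: "0 < \<alpha>" "\<alpha> < 1" and "0 \<le> lam" "0 \<le> \<mu>" and \<beta>: "0 < \<beta>" "2 * lam + \<mu> \<le> (\<beta> / 2) powr \<alpha>"
    and \<tau>: "0 < \<tau>" "\<beta> * \<tau> \<le> 1" and y0: "y 0 \<le> 1"
    and y: "\<And>n. 1 \<le> n \<Longrightarrow> n \<le> N \<Longrightarrow>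
      \<tau> powr (- \<alpha>) * (\<Sum>j=0..n. bw \<alpha> (n - j) * y j) \<le> lam * (y n + y (n - 1)) + \<mu>"
    and "n \<le> N"
  shows "y n \<le> exp (\<beta> * (real n * \<tau>))"
  using \<open>n \<le> N\<close>
proof (induction n rule: less_induct)
  case (less n)
  define e where "e j = exp (\<beta> * (real j * \<tau>))" for j
  define q where "q = exp (- (\<beta> * \<tau>))"
  show ?case
  proof (cases "n = 0")
    case True
    then show ?thesis using y0 by simp
  next
    case False
    then have n: "1 \<le> n" by simp
    have q: "0 < q" "q < 1" unfolding q_def using \<beta> \<tau> by auto
    have x: "0 < \<beta> * \<tau>" using \<beta> \<tau> by simp
    \<comment> \<open>The aim is a lower bound for \<open>1 - q\<close> that is linear in \<tau>.
      With \<open>x = \<beta> * \<tau>\<close>, the estimate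
      \<open>1 / (1 + x) \<le> 1 - x / 2\<close> holds for \<open>0 \<le> x \<le> 1\<close>; here
      the smallness of the time step enters.\<close>
    have "1 + \<beta> * \<tau> \<le> exp (\<beta> * \<tau>)" by (rule exp_ge_add_one_self)
    then have "q \<le> 1 / (1 + \<beta> * \<tau>)"
      using x unfolding q_def exp_minus by (simp add: field_simps)
    also have "\<dots> \<le> 1 - \<beta> * \<tau> / 2"
    proof -
      have "0 \<le> \<beta> * \<tau> * (1 - \<beta> * \<tau>)" using x \<tau> by simp
      then have "1 \<le> (1 - \<beta> * \<tau> / 2) * (1 + \<beta> * \<tau>)"
        by (simp add: algebra_simps)
      then show ?thesis using x by (simp add: pos_divide_le_eq)
    qed
    finally have "(\<beta> / 2) * \<tau> \<le> 1 - q" by simp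
    then have "((\<beta> / 2) * \<tau>) powr \<alpha> \<le> (1 - q) powr \<alpha>"
      using \<alpha> x by (intro powr_mono2) auto
    then have *: "(\<beta> / 2) powr \<alpha> * \<tau> powr \<alpha> \<le> (1 - q) powr \<alpha>"
      using powr_mult[of "\<beta> / 2" \<tau> \<alpha>] \<beta> \<tau> by simp
    have tt: "\<tau> powr (- \<alpha>) * \<tau> powr \<alpha> = 1"
      using \<tau> by (simp flip: powr_add)
    have tp: "0 < \<tau> powr (- \<alpha>)" using \<tau> by simp
    \<comment> \<open>The powers of \<tau> cancel, so a \<beta> chosen from \<open>lam\<close> and
      \<mu> alone works for every admissible time step.\<close>
    have lq: "2 * lam + \<mu> \<le> \<tau> powr (- \<alpha>) * (1 - q) powr \<alpha>"
    proof -
      have "(\<beta> / 2) powr \<alpha> = \<tau> powr (- \<alpha>) * ((\<beta> / 2) powr \<alpha> * \<tau> powr \<alpha>)"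
        using tt by (metis mult.left_commute mult.right_neutral)
      also have "\<dots> \<le> \<tau> powr (- \<alpha>) * (1 - q) powr \<alpha>"
        using * tp by (intro mult_left_mono) auto
      finally show ?thesis using \<beta> by simp
    qed
    also have "\<dots> \<le> \<tau> powr (- \<alpha>) * 1"
      using q \<alpha> tp by (intro mult_left_mono powr_le1) auto
    \<comment> \<open>This makes the final coefficient \<open>\<tau> powr (- \<alpha>) - lam\<close>
      of \<open>w n\<close> positive, so the implicit term is absorbed. For \<open>lam > 0\<close>
      strictness comes from the factor in \<open>2 * lam\<close>.\<close>
    finally have lam: "lam < \<tau> powr (- \<alpha>)"
      using \<open>0 \<le> lam\<close> \<open>0 \<le> \<mu>\<close> tp by (cases "lam = 0") auto
    \<comment> \<open>Going back one time level multiplies the exponential by \<open>q\<close>,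
      which turns the discrete convolution into \<open>e n\<close> times a partial sum of the
      binomial series at \<open>q\<close>.\<close>
    have e_rev: "e j = e n * q ^ (n - j)" if "j \<le> n" for j
    proof -
      have "real j = real n - real (n - j)"
        using that by simp
      then have "\<beta> * (real j * \<tau>) = \<beta> * ((real n - real (n - j)) * \<tau>)"
        by (rule arg_cong)
      also have "\<dots> = \<beta> * (real n * \<tau>) + real (n - j) * (- (\<beta> * \<tau>))"
        by (simp only: left_diff_distrib right_diff_distrib mult_minus_right mult.left_commute diff_conv_add_uminus[symmetric])
      finally have "\<beta> * (real j * \<tau>) = \<beta> * (real n * \<tau>) + real (n - j) * (- (\<beta> * \<tau>))" .
      then show ?thesis
        unfolding e_def q_def exp_of_nat_mult[symmetric] exp_add[symmetric] by simp
    qed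
    have "(\<Sum>j=0..n. bw \<alpha> (n - j) * e j) = (\<Sum>j=0..n. e n * (bw \<alpha> (n - j) * q ^ (n - j)))"
    proof (intro sum.cong refl)
      fix j assume "j \<in> {0..n}"
      then show "bw \<alpha> (n - j) * e j = e n * (bw \<alpha> (n - j) * q ^ (n - j))"
        using e_rev[of j] by simp
    qed
    also have "\<dots> = e n * (\<Sum>k=0..n. bw \<alpha> k * q ^ k)"
      unfolding sum_distrib_left[symmetric]
      using sum.atLeastAtMost_rev[of "\<lambda>k. bw \<alpha> k * q ^ k" 0 n] by simp
    finally have se: "(\<Sum>j=0..n. bw \<alpha> (n - j) * e j) = e n * (\<Sum>k=0..n. bw \<alpha> k * q ^ k)" .
    have e1: "1 \<le> e n" unfolding e_def using \<beta> \<tau> by simp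
    have e2: "e (n - 1) \<le> e n" unfolding e_def using \<beta> \<tau> by simp
    \<comment> \<open>Because \<open>e n \<ge> 1\<close>, the constant source \<mu> can be treated
      as a further linear term \<open>\<mu> * e n\<close>.\<close>
    have "lam * (e n + e (n - 1)) + \<mu> \<le> lam * (2 * e n) + \<mu> * e n"
      using e1 e2 assms by (intro add_mono mult_left_mono) (auto simp: mult_le_cancel_left1)
    also have "\<dots> = (2 * lam + \<mu>) * e n" by (simp add: algebra_simps)
    also have "\<dots> \<le> (\<tau> powr (- \<alpha>) * (1 - q) powr \<alpha>) * e n"
      using lq e1 by (intro mult_right_mono) auto
    also have "\<dots> \<le> (\<tau> powr (- \<alpha>) * (\<Sum>k=0..n. bw \<alpha> k * q ^ k)) * e n"
      using sum_bw_power_ge[OF \<alpha> q] tp e1 by (intro mult_right_mono mult_left_mono) auto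
    finally have super: "lam * (e n + e (n - 1)) + \<mu> \<le> \<tau> powr (- \<alpha>) * (\<Sum>j=0..n. bw \<alpha> (n - j) * e j)"
      unfolding se by (simp add: mult_ac)
    define w where "w j = e j - y j" for j
    have w: "0 \<le> w j" if "j < n" for j
      using less that unfolding w_def e_def by simp
    have "lam * (w n + w (n - 1)) \<le> \<tau> powr (- \<alpha>) * (\<Sum>j=0..n. bw \<alpha> (n - j) * w j)"
      using super y[OF n less.prems] unfolding w_def
      by (simp add: right_diff_distrib sum_subtractf algebra_simps)
    also have "\<dots> = \<tau> powr (- \<alpha>) * w n + \<tau> powr (- \<alpha>) * (\<Sum>j<n. bw \<alpha> (n - j) * w j)"
      by (simp add: sum_split_last bw_0[OF \<alpha>(1)] algebra_simps)
    also have "\<dots> \<le> \<tau> powr (- \<alpha>) * w n"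
    proof -
      have "(\<Sum>j<n. bw \<alpha> (n - j) * w j) \<le> 0"
        using w bw_nonpos[OF \<alpha>] by (intro sum_nonpos mult_nonpos_nonneg) auto
      then show ?thesis
        using mult_nonneg_nonpos[OF less_imp_le[OF tp]] by simp
    qed
    finally have "lam * w (n - 1) \<le> (\<tau> powr (- \<alpha>) - lam) * w n"
      by (simp add: algebra_simps)
    moreover have "0 \<le> lam * w (n - 1)" using w[of "n - 1"] n \<open>0 \<le> lam\<close> by simp
    ultimately have "0 \<le> (\<tau> powr (- \<alpha>) - lam) * w n" by linarith
    then have "0 \<le> w n" using lam by (simp add: zero_le_mult_iff)
    then show ?thesis unfolding w_def e_def by simp
  qed
qed

section \<open>Integration over the domain and over the mesh\<close>

text \<open>Continuity gives absolute integrability on a box around \<Omega>, which passes to the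
  measurable subset \<Omega>. Continuity on the whole space matches the extension by zero in
  \<open>Xh\<close> and excludes blow-up at the boundary.\<close>

lemma continuous_integrable_on_bounded_open:
  fixes \<Omega> :: "'a::euclidean_space set" and g :: "'a \<Rightarrow> real"
  assumes "open \<Omega>" "bounded \<Omega>" "continuous_on UNIV g"
  shows "g integrable_on \<Omega>"
proof -
  obtain a where a: "\<Omega> \<subseteq> cbox (- a) a"
    using bounded_subset_cbox_symmetric[OF assms(2)] by blast
  have "g absolutely_integrable_on cbox (- a) a"
    using assms(3) by (intro absolutely_integrable_continuous) (rule continuous_on_subset, auto)
  then have "g absolutely_integrable_on \<Omega>"
    using a assms(1) by (rule_tac set_integrable_subset) auto
  then show ?thesis
    by (rule set_lebesgue_integral_eq_integral(1))
qed

text \<open>Intended for products of finite element gradients: they are constant inside each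
  element, and the values of \<open>grad\<close> on the skeleton, where no derivative need exist,
  are confined to a null set.\<close>

lemma piecewise_constant_integrable_on:
  fixes \<Omega> :: "'a::euclidean_space set" and g :: "'a \<Rightarrow> real"
  assumes "open \<Omega>" "bounded \<Omega>" "finite \<T>"
    and const: "\<And>K. K \<in> \<T> \<Longrightarrow> \<exists>c. \<forall>x\<in>interior K. g x = c"
    and neg: "negligible (\<Omega> - (\<Union>K\<in>\<T>. interior K))"
  shows "g integrable_on \<Omega>"
proof -
  have piece: "g absolutely_integrable_on (\<Omega> \<inter> interior K)" if K: "K \<in> \<T>" for K
  proof -
    obtain c where c: "\<And>x. x \<in> interior K \<Longrightarrow> g x = c"
      using const[OF K] by blast
    have "bounded (\<Omega> \<inter> interior K)" "open (\<Omega> \<inter> interior K)"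
      using assms(1,2) by (auto intro: bounded_Int)
    then have "\<Omega> \<inter> interior K \<in> lmeasurable"
      by (rule lmeasurable_open)
    then have "(\<lambda>x. c) absolutely_integrable_on (\<Omega> \<inter> interior K)"
      by (simp add: absolutely_integrable_on_def integrable_on_const)
    then show ?thesis
      by (rule set_integrable_cong[THEN iffD1, rotated 3]) (auto simp: c)
  qed
  have "g absolutely_integrable_on (\<Union>K\<in>\<S>. \<Omega> \<inter> interior K)" if "\<S> \<subseteq> \<T>" for \<S>
    using finite_subset[OF that assms(3)] that
  proof (induction \<S> rule: finite_induct)
    case empty
    then show ?case by simp
  next
    case (insert K \<S>)
    then show ?case by (auto intro: absolutely_integrable_Un piece)
  qed
  then have "g integrable_on (\<Union>K\<in>\<T>. \<Omega> \<inter> interior K)"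
    by (intro set_lebesgue_integral_eq_integral(1)) simp
  then show ?thesis
  proof (rule integrable_spike_set)
    show "negligible {x \<in> (\<Union>K\<in>\<T>. \<Omega> \<inter> interior K) - \<Omega>. g x \<noteq> 0}"
      by (rule negligible_subset[OF negligible_empty]) auto
    show "negligible {x \<in> \<Omega> - (\<Union>K\<in>\<T>. \<Omega> \<inter> interior K). g x \<noteq> 0}"
      by (rule negligible_subset[OF neg]) auto
  qed
qed

text \<open>Values in a general inner product space let one statement cover both the functions and
  their gradients.\<close>

lemma integral_bw_energy_inequality:
  fixes \<Phi> :: "nat \<Rightarrow> 'a::euclidean_space \<Rightarrow> 'b::real_inner"
  assumes "0 < \<alpha>" "\<alpha> < 1" and n: "1 \<le> n"
    and int: "\<And>i j. i \<le> n \<Longrightarrow> j \<le> n \<Longrightarrow> (\<lambda>x. \<Phi> i x \<bullet> \<Phi> j x) integrable_on \<Omega>"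
  shows "(\<Sum>j=0..n. bw \<alpha> (n - j) * integral \<Omega> (\<lambda>x. (norm (\<Phi> j x))\<^sup>2)) / 2
    \<le> integral \<Omega> (\<lambda>x. (\<Sum>j=0..n. bw \<alpha> (n - j) *\<^sub>R \<Phi> j x)
          \<bullet> ((1 - \<alpha> / 2) *\<^sub>R \<Phi> n x + (\<alpha> / 2) *\<^sub>R \<Phi> (n - 1) x))"
proof -
  have sq: "(\<lambda>x. (norm (\<Phi> j x))\<^sup>2) integrable_on \<Omega>" if "j \<le> n" for j
    using int[OF that that] by (simp add: power2_norm_eq_inner)
  have "(\<Sum>j=0..n. bw \<alpha> (n - j) * integral \<Omega> (\<lambda>x. (norm (\<Phi> j x))\<^sup>2)) / 2
      = integral \<Omega> (\<lambda>x. (\<Sum>j=0..n. bw \<alpha> (n - j) * (norm (\<Phi> j x))\<^sup>2) / 2)"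
  proof -
    have "(\<lambda>x. bw \<alpha> (n - j) * (norm (\<Phi> j x))\<^sup>2) integrable_on \<Omega>" if "j \<in> {0..n}" for j
      using sq that by (intro integrable_on_mult_right) auto
    then have "integral \<Omega> (\<lambda>x. \<Sum>j=0..n. bw \<alpha> (n - j) * (norm (\<Phi> j x))\<^sup>2)
        = (\<Sum>j=0..n. integral \<Omega> (\<lambda>x. bw \<alpha> (n - j) * (norm (\<Phi> j x))\<^sup>2))"
      by (intro integral_sum) auto
    then show ?thesis by simp
  qed
  also have "\<dots> \<le> integral \<Omega> (\<lambda>x. (\<Sum>j=0..n. bw \<alpha> (n - j) *\<^sub>R \<Phi> j x)
          \<bullet> ((1 - \<alpha> / 2) *\<^sub>R \<Phi> n x + (\<alpha> / 2) *\<^sub>R \<Phi> (n - 1) x))"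
  proof (rule integral_le)
    show "(\<lambda>x. (\<Sum>j=0..n. bw \<alpha> (n - j) * (norm (\<Phi> j x))\<^sup>2) / 2) integrable_on \<Omega>"
      using sq by (intro integrable_on_divide integrable_sum integrable_on_mult_right) auto
    \<comment> \<open>Expanding into pairings of time levels reduces integrability to
      \<open>int\<close>.\<close>
    have "(\<lambda>x. \<Sum>j=0..n. (1 - \<alpha> / 2) * (bw \<alpha> (n - j) * (\<Phi> j x \<bullet> \<Phi> n x))
          + (\<alpha> / 2) * (bw \<alpha> (n - j) * (\<Phi> j x \<bullet> \<Phi> (n - 1) x)))
        integrable_on \<Omega>"
      by (intro integrable_sum integrable_on_mult_right integrable_add int) auto
    then show "(\<lambda>x. (\<Sum>j=0..n. bw \<alpha> (n - j) *\<^sub>R \<Phi> j x)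
          \<bullet> ((1 - \<alpha> / 2) *\<^sub>R \<Phi> n x + (\<alpha> / 2) *\<^sub>R \<Phi> (n - 1) x)) integrable_on \<Omega>"
      unfolding inner_sum_left
      by (simp only: inner_add_right inner_scaleR_left inner_scaleR_right)
  qed (rule bw_energy_inequality[OF assms(1,2) n])
  finally show ?thesis .
qed

section \<open>Finite element functions\<close>

lemma grad_eqI:
  assumes "(u has_derivative (\<lambda>h. c \<bullet> h)) (at x)"
  shows "grad u x = c"
  unfolding grad_def frechet_derivative_at[OF assms, symmetric]
  by (rule euclidean_representation)

lemma affine_piece_has_derivative:
  fixes u :: "'a::euclidean_space \<Rightarrow> real"
  assumes "\<And>y. y \<in> K \<Longrightarrow> u y = c \<bullet> y + b" "x \<in> interior K"
  shows "(u has_derivative (\<lambda>h. c \<bullet> h)) (at x)"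
proof (rule has_derivative_transform_within_open)
  show "((\<lambda>y. c \<bullet> y + b) has_derivative (\<lambda>h. c \<bullet> h)) (at x)"
    by (auto intro!: derivative_eq_intros)
  show "c \<bullet> y + b = u y" if "y \<in> interior K" for y
    using assms(1)[of y] that interior_subset[of K] by auto
qed (use assms in auto)

lemma Xh_grad_constant:
  assumes "u \<in> Xh \<Omega> Th" "K \<in> Th"
  shows "\<exists>c. \<forall>x\<in>interior K. (u has_derivative (\<lambda>h. c \<bullet> h)) (at x) \<and> grad u x = c"
proof -
  obtain c b where "\<forall>x\<in>K. u x = c \<bullet> x + b"
    using assms unfolding Xh_def by blast
  then have "\<forall>x\<in>interior K. (u has_derivative (\<lambda>h. c \<bullet> h)) (at x)"
    using affine_piece_has_derivative by blast
  then show ?thesis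
    using grad_eqI by blast
qed

text \<open>Interior points of elements are points where every summand is differentiable, so the sum
  rule applies to the derivative that \<open>grad\<close> selects.\<close>

lemma grad_sum:
  assumes "\<And>j. j \<in> J \<Longrightarrow> u j \<in> Xh \<Omega> Th" "x \<in> (\<Union>K\<in>Th. interior K)"
  shows "grad (\<lambda>x. \<Sum>j\<in>J. c j * u j x) x = (\<Sum>j\<in>J. c j *\<^sub>R grad (u j) x)"
proof (rule grad_eqI)
  have "(u j has_derivative (\<lambda>h. grad (u j) x \<bullet> h)) (at x)" if "j \<in> J" for j
  proof -
    obtain K where "K \<in> Th" "x \<in> interior K"
      using assms(2) by blast
    then show ?thesis
      using Xh_grad_constant[OF assms(1)[OF that]] by fastforce
  qed
  then have "((\<lambda>x. \<Sum>j\<in>J. c j * u j x) has_derivative (\<lambda>h. \<Sum>j\<in>J. c j * (grad (u j) x \<bullet> h))) (at x)"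
    by (intro has_derivative_sum has_derivative_mult_right)
  then show "((\<lambda>x. \<Sum>j\<in>J. c j * u j x) has_derivative (\<lambda>h. (\<Sum>j\<in>J. c j *\<^sub>R grad (u j) x) \<bullet> h)) (at x)"
    by (simp add: inner_sum_left)
qed

lemma Xh_lincomb:
  assumes "u \<in> Xh \<Omega> Th" "v \<in> Xh \<Omega> Th"
  shows "(\<lambda>x. a * u x + b * v x) \<in> Xh \<Omega> Th"
proof -
  have "\<exists>c d. \<forall>x\<in>K. a * u x + b * v x = c \<bullet> x + d" if K: "K \<in> Th" for K
  proof -
    obtain c1 d1 where "\<forall>x\<in>K. u x = c1 \<bullet> x + d1"
      using assms(1) K unfolding Xh_def by blast
    moreover obtain c2 d2 where "\<forall>x\<in>K. v x = c2 \<bullet> x + d2"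
      using assms(2) K unfolding Xh_def by blast
    ultimately have "\<forall>x\<in>K. a * u x + b * v x = (a *\<^sub>R c1 + b *\<^sub>R c2) \<bullet> x + (a * d1 + b * d2)"
      by (simp add: inner_add_left algebra_simps)
    then show ?thesis by blast
  qed
  then show ?thesis
    using assms unfolding Xh_def by (auto intro!: continuous_intros)
qed

text \<open>Makes \<open>Dfrac\<close> and \<open>shiftw\<close> of a discrete solution admissible
  test functions.\<close>

lemma Xh_sum:
  fixes u :: "'i \<Rightarrow> 'a::euclidean_space \<Rightarrow> real"
  assumes "finite J" "\<And>j. j \<in> J \<Longrightarrow> u j \<in> Xh \<Omega> Th"
  shows "(\<lambda>x. \<Sum>j\<in>J. c j * u j x) \<in> Xh \<Omega> Th"
  using assms
proof (induction J rule: finite_induct)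
  case empty
  have "\<exists>c b. \<forall>x\<in>K. (0::real) = c \<bullet> x + b" for K :: "'a set"
    by (intro exI[of _ 0]) simp
  then show ?case by (simp add: Xh_def)
next
  case (insert j J)
  then show ?case
    using Xh_lincomb[of "u j" \<Omega> Th "\<lambda>x. \<Sum>j\<in>J. c j * u j x" "c j" 1] by simp
qed

text \<open>Simplices are convex, so their boundaries are null sets, and the mesh has finitely many
  of them.\<close>

lemma mesh_negligible_skeleton:
  fixes \<Omega> :: "'a::euclidean_space set"
  assumes "quasi_uniform_mesh \<sigma> \<Omega> Th"
  shows "negligible (\<Omega> - (\<Union>K\<in>Th. interior K))"
proof (rule negligible_subset)
  have "negligible (frontier K)" if "K \<in> Th" for K
    using assms that unfolding quasi_uniform_mesh_def is_simplex_def
    by (metis convex_convex_hull negligible_convex_frontier)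
  then show "negligible (\<Union>K\<in>Th. frontier K)"
    using assms unfolding quasi_uniform_mesh_def by (auto intro: negligible_Union)
  have "\<Omega> \<subseteq> \<Union>Th"
    using assms closure_subset[of \<Omega>] unfolding quasi_uniform_mesh_def by simp
  moreover have "K - interior K \<subseteq> frontier K" for K :: "'a set"
    using closure_subset[of K] unfolding frontier_def by blast
  ultimately show "\<Omega> - (\<Union>K\<in>Th. interior K) \<subseteq> (\<Union>K\<in>Th. frontier K)"
    by blast
qed

lemma Xh_grad_inner_integrable_on:
  assumes "quasi_uniform_mesh \<sigma> \<Omega> Th" "open \<Omega>" "bounded \<Omega>" "u \<in> Xh \<Omega> Th" "v \<in> Xh \<Omega> Th"
  shows "(\<lambda>x. grad u x \<bullet> grad v x) integrable_on \<Omega>"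
proof (rule piecewise_constant_integrable_on[OF assms(2,3) _ _ mesh_negligible_skeleton[OF assms(1)]])
  show "finite Th"
    using assms(1) unfolding quasi_uniform_mesh_def by blast
  show "\<exists>c. \<forall>x\<in>interior K. grad u x \<bullet> grad v x = c" if "K \<in> Th" for K
    using Xh_grad_constant[OF assms(4) that] Xh_grad_constant[OF assms(5) that] by metis
qed

text \<open>Convexity of the square: \<open>shiftw\<close> is a convex combination, and its weights
  are then enlarged to 1.\<close>

lemma shiftw_sq_le:
  assumes "0 < \<alpha>" "\<alpha> < 1"
  shows "(shiftw \<alpha> \<phi> n x)\<^sup>2 \<le> (\<phi> n x)\<^sup>2 + (\<phi> (n - 1) x)\<^sup>2"
proof -
  let ?a = "\<phi> n x" and ?b = "\<phi> (n - 1) x"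
  have "(shiftw \<alpha> \<phi> n x)\<^sup>2 = (1 - \<alpha> / 2) * ?a\<^sup>2 + (\<alpha> / 2) * ?b\<^sup>2 - (1 - \<alpha> / 2) * (\<alpha> / 2) * (?a - ?b)\<^sup>2"
    unfolding shiftw_def by (simp add: power2_eq_square field_simps)
  moreover have "0 \<le> (1 - \<alpha> / 2) * (\<alpha> / 2) * (?a - ?b)\<^sup>2"
    using assms by simp
  moreover have "(1 - \<alpha> / 2) * ?a\<^sup>2 \<le> 1 * ?a\<^sup>2" "(\<alpha> / 2) * ?b\<^sup>2 \<le> 1 * ?b\<^sup>2"
    using assms by (intro mult_right_mono; simp)+
  ultimately show ?thesis by linarith
qed

section \<open>A priori estimates for the scheme\<close>

text \<open>The nonlocal coefficient is frozen to a number \<open>m\<close> and the source to a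
  function \<open>g\<close>, so both equations of the system are instances. The first bound tests
  with the shifted value, the second with the discrete derivative.\<close>

lemma scheme_component_estimates:
  fixes \<Omega> :: "'a::euclidean_space set" and W :: "nat \<Rightarrow> 'a \<Rightarrow> real"
  assumes dom: "open \<Omega>" "bounded \<Omega>" and \<alpha>: "0 < \<alpha>" "\<alpha> < 1" and \<tau>: "0 < \<tau>"
    and mesh: "quasi_uniform_mesh \<sigma> \<Omega> Th"
    and n: "1 \<le> n" and W_Xh: "\<forall>j\<le>n. W j \<in> Xh \<Omega> Th"
    and g: "continuous_on UNIV g" and m: "0 < m1" "m1 \<le> m"
    and weak: "\<forall>w\<in>Xh \<Omega> Th.
      L2_inner \<Omega> (Dfrac \<alpha> \<tau> W n) w + m * grad_inner \<Omega> (shiftw \<alpha> W n) w = L2_inner \<Omega> g w"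
  shows "\<tau> powr (- \<alpha>) * (\<Sum>j=0..n. bw \<alpha> (n - j) * integral \<Omega> (\<lambda>x. (W j x)\<^sup>2))
      \<le> integral \<Omega> (\<lambda>x. (g x)\<^sup>2) + integral \<Omega> (\<lambda>x. (shiftw \<alpha> W n x)\<^sup>2)" (is ?L2)
    and "\<tau> powr (- \<alpha>) * (\<Sum>j=0..n. bw \<alpha> (n - j) * integral \<Omega> (\<lambda>x. (norm (grad (W j) x))\<^sup>2))
      \<le> integral \<Omega> (\<lambda>x. (g x)\<^sup>2) / (2 * m1)" (is ?grad)
proof -
  note int = continuous_integrable_on_bounded_open[OF dom]
  note W = W_Xh[rule_format] and eq = weak[rule_format]
  define s where "s = shiftw \<alpha> W n"
  define D where "D = Dfrac \<alpha> \<tau> W n"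
  have cont_Xh: "continuous_on UNIV w" if "w \<in> Xh \<Omega> Th" for w
    using that unfolding Xh_def by blast
  have Ddef: "D = (\<lambda>x. \<Sum>j=0..n. (\<tau> powr (- \<alpha>) * bw \<alpha> (n - j)) * W j x)"
    unfolding D_def Dfrac_def by (simp add: sum_distrib_left mult.assoc)
  have D: "D \<in> Xh \<Omega> Th"
    unfolding Ddef using W by (intro Xh_sum) auto
  \<comment> \<open>Written as a finite sum so that \<open>Xh_sum\<close> and
    \<open>grad_sum\<close> apply; \<open>n \<ge> 1\<close> keeps the indices \<open>n - 1\<close>
    and \<open>n\<close> distinct.\<close>
  have sdef: "s = (\<lambda>x. \<Sum>j\<in>{n - 1, n}. (if j = n then 1 - \<alpha> / 2 else \<alpha> / 2) * W j x)"
    unfolding s_def shiftw_def using n by (intro ext) auto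
  have s: "s \<in> Xh \<Omega> Th"
    unfolding sdef using W by (intro Xh_sum) auto
  note cont = cont_Xh[OF D] cont_Xh[OF s] g
  have tp: "0 < \<tau> powr (- \<alpha>)" using \<tau> by simp

  have "(\<Sum>j=0..n. bw \<alpha> (n - j) * integral \<Omega> (\<lambda>x. (norm (W j x))\<^sup>2)) / 2
    \<le> integral \<Omega> (\<lambda>x. (\<Sum>j=0..n. bw \<alpha> (n - j) *\<^sub>R W j x)
          \<bullet> ((1 - \<alpha> / 2) *\<^sub>R W n x + (\<alpha> / 2) *\<^sub>R W (n - 1) x))"
    using W cont_Xh by (intro integral_bw_energy_inequality \<alpha> n int) (auto intro!: continuous_intros)
  from mult_left_mono[OF this less_imp_le[OF tp]]
  have "\<tau> powr (- \<alpha>) * (\<Sum>j=0..n. bw \<alpha> (n - j) * integral \<Omega> (\<lambda>x. (W j x)\<^sup>2)) / 2 \<le> L2_inner \<Omega> D s"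
    unfolding L2_inner_def D_def s_def Dfrac_def shiftw_def
    by (simp add: mult.assoc)
  moreover have "0 \<le> m * grad_inner \<Omega> s s"
    unfolding grad_inner_def using m
    by (intro mult_nonneg_nonneg integral_nonneg Xh_grad_inner_integrable_on[OF mesh dom s s]) auto
  moreover have "L2_inner \<Omega> D s + m * grad_inner \<Omega> s s = L2_inner \<Omega> g s"
    using eq[OF s] unfolding D_def s_def .
  moreover have "L2_inner \<Omega> g s \<le> integral \<Omega> (\<lambda>x. (g x)\<^sup>2 / 2 + (s x)\<^sup>2 / 2)"
    unfolding L2_inner_def
  proof (rule integral_le)
    show "g x * s x \<le> (g x)\<^sup>2 / 2 + (s x)\<^sup>2 / 2" for x
      using sum_squares_bound[of "g x" "s x"] by simp
  qed (auto intro!: int continuous_intros cont)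
  moreover have "integral \<Omega> (\<lambda>x. (g x)\<^sup>2 / 2 + (s x)\<^sup>2 / 2)
      = integral \<Omega> (\<lambda>x. (g x)\<^sup>2) / 2 + integral \<Omega> (\<lambda>x. (s x)\<^sup>2) / 2"
    by (subst integral_add) (auto intro!: int continuous_intros cont)
  ultimately show ?L2
    unfolding s_def by argo

  have "(\<Sum>j=0..n. bw \<alpha> (n - j) * integral \<Omega> (\<lambda>x. (norm (grad (W j) x))\<^sup>2)) / 2
    \<le> integral \<Omega> (\<lambda>x. (\<Sum>j=0..n. bw \<alpha> (n - j) *\<^sub>R grad (W j) x)
          \<bullet> ((1 - \<alpha> / 2) *\<^sub>R grad (W n) x + (\<alpha> / 2) *\<^sub>R grad (W (n - 1)) x))"
    using W by (intro integral_bw_energy_inequality \<alpha> n Xh_grad_inner_integrable_on[OF mesh dom]) auto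
  \<comment> \<open>The gradients of \<open>D\<close> and \<open>s\<close> are known to be the
    expected combinations off the skeleton, so the integrals are compared up to a null set.\<close>
  moreover have "\<tau> powr (- \<alpha>) * integral \<Omega> (\<lambda>x. (\<Sum>j=0..n. bw \<alpha> (n - j) *\<^sub>R grad (W j) x)
          \<bullet> ((1 - \<alpha> / 2) *\<^sub>R grad (W n) x + (\<alpha> / 2) *\<^sub>R grad (W (n - 1)) x)) = grad_inner \<Omega> s D"
    unfolding grad_inner_def integral_mult_right[symmetric]
  proof (rule integral_spike[OF mesh_negligible_skeleton[OF mesh]])
    fix x assume "x \<in> \<Omega> - (\<Omega> - (\<Union>K\<in>Th. interior K))"
    then have x: "x \<in> (\<Union>K\<in>Th. interior K)" by blast
    have "grad D x = \<tau> powr (- \<alpha>) *\<^sub>R (\<Sum>j=0..n. bw \<alpha> (n - j) *\<^sub>R grad (W j) x)"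
      unfolding Ddef by (subst grad_sum[where \<Omega> = \<Omega>, OF _ x]) (auto simp: W scaleR_sum_right)
    moreover have "grad s x = (1 - \<alpha> / 2) *\<^sub>R grad (W n) x + (\<alpha> / 2) *\<^sub>R grad (W (n - 1)) x"
      unfolding sdef using n by (subst grad_sum[where \<Omega> = \<Omega>, OF _ x]) (auto simp: W)
    ultimately show "grad s x \<bullet> grad D x = \<tau> powr (- \<alpha>) * ((\<Sum>j=0..n. bw \<alpha> (n - j) *\<^sub>R grad (W j) x)
          \<bullet> ((1 - \<alpha> / 2) *\<^sub>R grad (W n) x + (\<alpha> / 2) *\<^sub>R grad (W (n - 1)) x))"
      by (subst inner_commute) (simp only: inner_scaleR_left)
  qed
  ultimately have "\<tau> powr (- \<alpha>) * (\<Sum>j=0..n. bw \<alpha> (n - j) * integral \<Omega> (\<lambda>x. (norm (grad (W j) x))\<^sup>2)) / 2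
      \<le> grad_inner \<Omega> s D"
    using mult_left_mono[OF _ less_imp_le[OF tp]] by fastforce
  moreover have "grad_inner \<Omega> s D \<le> integral \<Omega> (\<lambda>x. (g x)\<^sup>2) / (4 * m1)"
  proof -
    \<comment> \<open>Young's inequality is weighted so that \<open>L2_inner \<Omega> D D\<close>
      has coefficient exactly one and cancels against the same term of the tested equation. No bound
      on \<open>D\<close> enters the constant.\<close>
    have "L2_inner \<Omega> g D \<le> integral \<Omega> (\<lambda>x. D x * D x + (g x)\<^sup>2 / 4)"
      unfolding L2_inner_def
    proof (rule integral_le)
      show "g x * D x \<le> D x * D x + (g x)\<^sup>2 / 4" for x
        using sum_squares_bound[of "g x / 2" "D x"] by (simp add: power2_eq_square)
    qed (auto intro!: int continuous_intros cont)
    also have "\<dots> = L2_inner \<Omega> D D + integral \<Omega> (\<lambda>x. (g x)\<^sup>2) / 4"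
      unfolding L2_inner_def by (subst integral_add) (auto intro!: int continuous_intros cont)
    finally have "m * grad_inner \<Omega> s D \<le> integral \<Omega> (\<lambda>x. (g x)\<^sup>2) / 4"
      using eq[OF D] unfolding D_def s_def by linarith
    then have "grad_inner \<Omega> s D \<le> (integral \<Omega> (\<lambda>x. (g x)\<^sup>2) / 4) / m"
      using m by (simp add: pos_le_divide_eq mult_ac)
    also have "\<dots> \<le> (integral \<Omega> (\<lambda>x. (g x)\<^sup>2) / 4) / m1"
      using m by (intro divide_left_mono) (auto intro!: integral_nonneg int continuous_intros cont)
    finally show ?thesis by simp
  qed
  ultimately show ?grad by simp
qed

section \<open>Lipschitz source terms\<close>

lemma continuous_on_lipschitz2_compose:
  fixes f :: "real \<Rightarrow> real \<Rightarrow> real" and s t :: "'a::topological_space \<Rightarrow> real"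
  assumes lip: "\<And>x1 y1 x2 y2. \<bar>f x1 y1 - f x2 y2\<bar> \<le> L * \<bar>x1 - x2\<bar> + K * \<bar>y1 - y2\<bar>"
    and "continuous_on UNIV s" "continuous_on UNIV t"
  shows "continuous_on UNIV (\<lambda>x. f (s x) (t x))"
  unfolding continuous_on_def
proof
  fix x
  have "(s \<longlongrightarrow> s x) (at x)" "(t \<longlongrightarrow> t x) (at x)"
    using assms(2,3) by (auto simp: continuous_on_def)
  then have "((\<lambda>y. L * \<bar>s y - s x\<bar> + K * \<bar>t y - t x\<bar>) \<longlongrightarrow> L * \<bar>s x - s x\<bar> + K * \<bar>t x - t x\<bar>) (at x)"
    by (intro tendsto_intros)
  then have "((\<lambda>y. L * \<bar>s y - s x\<bar> + K * \<bar>t y - t x\<bar>) \<longlongrightarrow> 0) (at x)"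
    by simp
  then have "((\<lambda>y. f (s y) (t y) - f (s x) (t x)) \<longlongrightarrow> 0) (at x)"
    by (rule Lim_null_comparison[rotated]) (simp add: lip)
  then show "((\<lambda>y. f (s y) (t y)) \<longlongrightarrow> f (s x) (t x)) (at x)"
    by (rule LIM_zero_cancel)
qed

text \<open>Comparison with the value at the origin gives the linear growth
  \<open>A + B * |x| + B * |y|\<close>; squaring three terms costs the factor 3. \<open>A\<close>
  and \<open>B\<close> are mere upper bounds, so one pair can serve both sources.\<close>

lemma integral_lipschitz2_sq_le:
  fixes \<Omega> :: "'a::euclidean_space set" and f :: "real \<Rightarrow> real \<Rightarrow> real"
  assumes dom: "open \<Omega>" "bounded \<Omega>"
    and lip: "\<And>x1 y1 x2 y2. \<bar>f x1 y1 - f x2 y2\<bar> \<le> L * \<bar>x1 - x2\<bar> + K * \<bar>y1 - y2\<bar>"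
    and cont: "continuous_on UNIV s" "continuous_on UNIV t"
    and bounds: "\<bar>f 0 0\<bar> \<le> A" "\<bar>L\<bar> \<le> B" "\<bar>K\<bar> \<le> B"
  shows "integral \<Omega> (\<lambda>x. (f (s x) (t x))\<^sup>2)
    \<le> 3 * A\<^sup>2 * integral \<Omega> (\<lambda>_. 1) + 3 * B\<^sup>2 * (integral \<Omega> (\<lambda>x. (s x)\<^sup>2) + integral \<Omega> (\<lambda>x. (t x)\<^sup>2))"
proof -
  note int = continuous_integrable_on_bounded_open[OF dom]
  have sq3: "(a + b + c)\<^sup>2 \<le> 3 * a\<^sup>2 + 3 * b\<^sup>2 + 3 * c\<^sup>2" for a b c :: real
  proof -
    have "0 \<le> (a - b)\<^sup>2 + (a - c)\<^sup>2 + (b - c)\<^sup>2" by simp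
    then show ?thesis by (simp add: power2_eq_square algebra_simps)
  qed
  have pt: "(f x y)\<^sup>2 \<le> 3 * A\<^sup>2 * 1 + (3 * B\<^sup>2 * x\<^sup>2 + 3 * B\<^sup>2 * y\<^sup>2)" for x y
  proof -
    have "L * \<bar>x\<bar> \<le> B * \<bar>x\<bar>" "K * \<bar>y\<bar> \<le> B * \<bar>y\<bar>"
      using bounds by (intro mult_right_mono; simp)+
    then have "\<bar>f x y\<bar> \<le> A + B * \<bar>x\<bar> + B * \<bar>y\<bar>"
      using lip[of x y 0 0] bounds(1) by (simp only: diff_zero) linarith
    then have "(f x y)\<^sup>2 \<le> (A + B * \<bar>x\<bar> + B * \<bar>y\<bar>)\<^sup>2"
      using abs_le_square_iff by fastforce
    also have "\<dots> \<le> 3 * A\<^sup>2 + 3 * (B * \<bar>x\<bar>)\<^sup>2 + 3 * (B * \<bar>y\<bar>)\<^sup>2"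
      by (rule sq3)
    finally show ?thesis by (simp add: power_mult_distrib)
  qed
  have i1: "(\<lambda>x. 3 * A\<^sup>2 * 1) integrable_on \<Omega>"
    "(\<lambda>x. 3 * B\<^sup>2 * (s x)\<^sup>2) integrable_on \<Omega>" "(\<lambda>x. 3 * B\<^sup>2 * (t x)\<^sup>2) integrable_on \<Omega>"
    by (intro int continuous_intros cont)+
  have "integral \<Omega> (\<lambda>x. (f (s x) (t x))\<^sup>2)
      \<le> integral \<Omega> (\<lambda>x. 3 * A\<^sup>2 * 1 + (3 * B\<^sup>2 * (s x)\<^sup>2 + 3 * B\<^sup>2 * (t x)\<^sup>2))"
  proof (rule integral_le)
    show "(\<lambda>x. (f (s x) (t x))\<^sup>2) integrable_on \<Omega>"
      by (intro int continuous_on_power continuous_on_lipschitz2_compose[OF lip] cont)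
  qed (intro integrable_add i1 pt)+
  also have "\<dots> = 3 * A\<^sup>2 * integral \<Omega> (\<lambda>_. 1) + (3 * B\<^sup>2 * integral \<Omega> (\<lambda>x. (s x)\<^sup>2) + 3 * B\<^sup>2 * integral \<Omega> (\<lambda>x. (t x)\<^sup>2))"
    unfolding integral_add[OF i1(1) integrable_add[OF i1(2,3)]] integral_add[OF i1(2,3)]
      integral_mult_right ..
  finally show ?thesis by (simp only: distrib_left)
qed

section \<open>Uniform bounds for the coupled system\<close>

theorem theorem1:
  fixes \<Omega> :: "'a::euclidean_space set"
    and \<alpha> T m1 m2 L1' K1' L2' K2' L1 K1 L2 K2 \<sigma> :: real
    and M1 M2 f1 f2 :: "real \<Rightarrow> real \<Rightarrow> real"
  assumes dim: "DIM('a) \<in> {1, 2, 3}"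
    and dom: "open \<Omega>" "connected \<Omega>" "bounded \<Omega>" "\<Omega> \<noteq> {}"
    and alpha: "0 < \<alpha>" "\<alpha> < 1"
    and Tpos: "T > 0"
    and H1: "0 < m1" "m1 \<le> m2"
      "\<And>x y. m1 \<le> M1 x y \<and> M1 x y \<le> m2"
      "\<And>x y. m1 \<le> M2 x y \<and> M2 x y \<le> m2"
    and H2: "\<And>x1 y1 x2 y2. \<bar>M1 x1 y1 - M1 x2 y2\<bar> \<le> L1' * \<bar>x1 - x2\<bar> + K1' * \<bar>y1 - y2\<bar>"
      "\<And>x1 y1 x2 y2. \<bar>M2 x1 y1 - M2 x2 y2\<bar> \<le> L2' * \<bar>x1 - x2\<bar> + K2' * \<bar>y1 - y2\<bar>"
    and H3: "\<And>x1 y1 x2 y2. \<bar>f1 x1 y1 - f1 x2 y2\<bar> \<le> L1 * \<bar>x1 - x2\<bar> + K1 * \<bar>y1 - y2\<bar>"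
      "\<And>x1 y1 x2 y2. \<bar>f2 x1 y1 - f2 x2 y2\<bar> \<le> L2 * \<bar>x1 - x2\<bar> + K2 * \<bar>y1 - y2\<bar>"
    and sigma: "\<sigma> > 0"
  shows "\<exists>\<tau>s>0. \<exists>C>0. \<forall>Th N U V.
           quasi_uniform_mesh \<sigma> \<Omega> Th \<longrightarrow> N \<ge> 1 \<longrightarrow> T / real N \<le> \<tau>s \<longrightarrow>
           solves_scheme \<Omega> Th \<alpha> T N M1 M2 f1 f2 U V \<longrightarrow>
           (\<forall>n\<in>{1..N}. L2_norm \<Omega> (U n) + L2_norm \<Omega> (V n) \<le> C \<and>
                         grad_norm \<Omega> (U n) + grad_norm \<Omega> (V n) \<le> C)"
proof -
  note int = continuous_integrable_on_bounded_open[OF dom(1,3)]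
  define A where "A = \<bar>f1 0 0\<bar> + \<bar>f2 0 0\<bar>"
  define L where "L = \<bar>L1\<bar> + \<bar>K1\<bar> + \<bar>L2\<bar> + \<bar>K2\<bar>"
  define B where "B = 3 * A\<^sup>2 * integral \<Omega> (\<lambda>_. 1::real)"
  define G where "G = 3 * L\<^sup>2"
  \<comment> \<open>Solves \<open>(\<beta> c / 2) powr \<alpha> = c + 1\<close>, which meets the
    growth condition of \<open>bw_gronwall\<close> for \<open>c = 2 * lam + \<mu>\<close>; the
    \<open>+ 1\<close> keeps \<open>\<beta> c\<close> positive at \<open>c = 0\<close>.\<close>
  define \<beta> where "\<beta> c = 2 * (c + 1) powr (1 / \<alpha>)" for c
  \<comment> \<open>The argument of \<beta> corresponds to \<open>lam = 2 * G + 1\<close> and source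
    \<open>2 * B\<close> in \<open>bw_gronwall\<close>.\<close>
  define R where "R = exp (\<beta> (2 * (2 * G + 1) + 2 * B) * T)"
  \<comment> \<open>The source in the gradient recursion once
    \<open>Y k + Y (k - 1) \<le> 2 * R\<close> is inserted.\<close>
  define \<mu> where "\<mu> = (2 * B + 4 * G * R) / (2 * m1)"
  define R' where "R' = exp (\<beta> \<mu> * T)"
  \<comment> \<open>Secures \<open>\<beta> * \<tau> \<le> 1\<close> in both uses of
    \<open>bw_gronwall\<close>. All these constants are fixed before the mesh, \<open>N\<close> and
    the solution, hence are independent of them.\<close>
  define \<tau>s where "\<tau>s = min (1 / \<beta> (2 * (2 * G + 1) + 2 * B)) (1 / \<beta> \<mu>)"
  have "0 \<le> integral \<Omega> (\<lambda>_. 1::real)"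
    by (intro integral_nonneg int) auto
  then have B: "0 \<le> B" unfolding B_def by simp
  have G: "0 \<le> G" unfolding G_def by simp
  have R: "0 < R" "0 < R'" unfolding R_def R'_def by simp_all
  have \<mu>: "0 \<le> \<mu>" unfolding \<mu>_def using B G R H1(1) by simp
  have \<beta>: "0 < \<beta> c" "c \<le> (\<beta> c / 2) powr \<alpha>" if "0 \<le> c" for c
    unfolding \<beta>_def using that alpha by (simp_all add: powr_powr)
  have \<beta>pos: "0 < \<beta> (2 * (2 * G + 1) + 2 * B)" "0 < \<beta> \<mu>"
    using \<beta>(1) B G \<mu> by simp_all
  then have \<tau>s: "0 < \<tau>s" unfolding \<tau>s_def by simp
  have main: "integral \<Omega> (\<lambda>x. (U n x)\<^sup>2) + integral \<Omega> (\<lambda>x. (V n x)\<^sup>2) \<le> R \<and>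
      integral \<Omega> (\<lambda>x. (norm (grad (U n) x))\<^sup>2) + integral \<Omega> (\<lambda>x. (norm (grad (V n) x))\<^sup>2) \<le> R'"
    if mesh: "quasi_uniform_mesh \<sigma> \<Omega> Th" and N: "1 \<le> N" and small: "T / real N \<le> \<tau>s"
      and sol: "solves_scheme \<Omega> Th \<alpha> T N M1 M2 f1 f2 U V" and "n \<le> N" for Th N U V n
  proof -
    define \<tau> where "\<tau> = T / real N"
    have \<tau>: "0 < \<tau>" unfolding \<tau>_def using Tpos N by simp
    have UV: "U j \<in> Xh \<Omega> Th" "V j \<in> Xh \<Omega> Th" if "j \<le> N" for j
      using sol that unfolding solves_scheme_def Let_def by blast+
    have UV0: "U 0 = (\<lambda>x. 0)" "V 0 = (\<lambda>x. 0)"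
      using sol unfolding solves_scheme_def Let_def by blast+
    define Y where "Y j = integral \<Omega> (\<lambda>x. (U j x)\<^sup>2) + integral \<Omega> (\<lambda>x. (V j x)\<^sup>2)" for j
    define Z where "Z j = integral \<Omega> (\<lambda>x. (norm (grad (U j) x))\<^sup>2) + integral \<Omega> (\<lambda>x. (norm (grad (V j) x))\<^sup>2)" for j
    have cont: "continuous_on UNIV (U j)" "continuous_on UNIV (V j)" if "j \<le> N" for j
      using UV[OF that] unfolding Xh_def by blast+
    \<comment> \<open>The two components are added because each source involves both unknowns; the
      sum satisfies a closed inequality.\<close>
    have est: "\<tau> powr (- \<alpha>) * (\<Sum>j=0..k. bw \<alpha> (k - j) * Y j) \<le> (2 * G + 1) * (Y k + Y (k - 1)) + 2 * B"
      "\<tau> powr (- \<alpha>) * (\<Sum>j=0..k. bw \<alpha> (k - j) * Z j) \<le> (2 * B + 2 * G * (Y k + Y (k - 1))) / (2 * m1)"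
      if k: "1 \<le> k" "k \<le> N" for k
    proof -
      define s where "s = shiftw \<alpha> U k"
      define t where "t = shiftw \<alpha> V k"
      define g1 where "g1 = (\<lambda>x. f1 (s x) (t x))"
      define g2 where "g2 = (\<lambda>x. f2 (s x) (t x))"
      have cont_st: "continuous_on UNIV s" "continuous_on UNIV t"
        unfolding s_def t_def shiftw_def using cont[of k] cont[of "k - 1"] k
        by (auto intro!: continuous_intros)
      have cont_g: "continuous_on UNIV g1" "continuous_on UNIV g2"
        unfolding g1_def g2_def
        by (rule continuous_on_lipschitz2_compose[OF H3(1) cont_st] continuous_on_lipschitz2_compose[OF H3(2) cont_st])+
      define S where "S = integral \<Omega> (\<lambda>x. (s x)\<^sup>2) + integral \<Omega> (\<lambda>x. (t x)\<^sup>2)"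
      have "integral \<Omega> (\<lambda>x. (s x)\<^sup>2) \<le> integral \<Omega> (\<lambda>x. (U k x)\<^sup>2 + (U (k - 1) x)\<^sup>2)"
        unfolding s_def using cont_st cont[of k] cont[of "k - 1"] k
        by (intro integral_le shiftw_sq_le alpha) (auto intro!: int continuous_intros simp: s_def)
      moreover have "integral \<Omega> (\<lambda>x. (t x)\<^sup>2) \<le> integral \<Omega> (\<lambda>x. (V k x)\<^sup>2 + (V (k - 1) x)\<^sup>2)"
        unfolding t_def using cont_st cont[of k] cont[of "k - 1"] k
        by (intro integral_le shiftw_sq_le alpha) (auto intro!: int continuous_intros simp: t_def)
      moreover have "integral \<Omega> (\<lambda>x. (U k x)\<^sup>2 + (U (k - 1) x)\<^sup>2) + integral \<Omega> (\<lambda>x. (V k x)\<^sup>2 + (V (k - 1) x)\<^sup>2)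
          = Y k + Y (k - 1)"
        unfolding Y_def using cont[of k] cont[of "k - 1"] k
        by (subst (1 2) integral_add) (auto intro!: int continuous_intros)
      ultimately have S: "S \<le> Y k + Y (k - 1)"
        unfolding S_def by linarith
      have g: "integral \<Omega> (\<lambda>x. (g1 x)\<^sup>2) \<le> B + G * S" "integral \<Omega> (\<lambda>x. (g2 x)\<^sup>2) \<le> B + G * S"
        unfolding g1_def g2_def B_def G_def S_def
        by (rule integral_lipschitz2_sq_le[OF dom(1,3) H3(1) cont_st] integral_lipschitz2_sq_le[OF dom(1,3) H3(2) cont_st];
            simp add: A_def L_def)+
      note comp = scheme_component_estimates[OF dom(1,3) alpha \<tau> mesh k(1)]
      have eqU: "\<forall>w\<in>Xh \<Omega> Th. L2_inner \<Omega> (Dfrac \<alpha> \<tau> U k) w + M1 (lfun \<Omega> s) (lfun \<Omega> t) * grad_inner \<Omega> (shiftw \<alpha> U k) w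
          = L2_inner \<Omega> g1 w"
        and eqV: "\<forall>w\<in>Xh \<Omega> Th. L2_inner \<Omega> (Dfrac \<alpha> \<tau> V k) w + M2 (lfun \<Omega> s) (lfun \<Omega> t) * grad_inner \<Omega> (shiftw \<alpha> V k) w
          = L2_inner \<Omega> g2 w"
        using sol k unfolding solves_scheme_def Let_def \<tau>_def s_def t_def g1_def g2_def by auto
      have m: "m1 \<le> M1 (lfun \<Omega> s) (lfun \<Omega> t)" "m1 \<le> M2 (lfun \<Omega> s) (lfun \<Omega> t)"
        using H1 by auto
      have mem: "\<forall>j\<le>k. U j \<in> Xh \<Omega> Th" "\<forall>j\<le>k. V j \<in> Xh \<Omega> Th"
        using UV k by simp_all
      note compU = comp[OF mem(1) cont_g(1) H1(1) m(1) eqU]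
        and compV = comp[OF mem(2) cont_g(2) H1(1) m(2) eqV]
      have GS: "G * S \<le> G * (Y k + Y (k - 1))"
        using S G by (rule mult_left_mono)
      have "\<tau> powr (- \<alpha>) * (\<Sum>j=0..k. bw \<alpha> (k - j) * Y j)
          = \<tau> powr (- \<alpha>) * (\<Sum>j=0..k. bw \<alpha> (k - j) * integral \<Omega> (\<lambda>x. (U j x)\<^sup>2))
          + \<tau> powr (- \<alpha>) * (\<Sum>j=0..k. bw \<alpha> (k - j) * integral \<Omega> (\<lambda>x. (V j x)\<^sup>2))"
        unfolding Y_def by (simp only: distrib_left sum.distrib)
      \<comment> \<open>Each source contributes \<open>B + G * S\<close>, and the two shifted terms
        together contribute one more \<open>S\<close>; hence the coefficient
        \<open>2 * G + 1\<close>.\<close>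
      also have "\<dots> \<le> 2 * (B + G * S) + S"
        using compU(1) compV(1) g unfolding s_def[symmetric] t_def[symmetric] S_def by argo
      also have "\<dots> \<le> (2 * G + 1) * (Y k + Y (k - 1)) + 2 * B"
        using GS S by (simp add: algebra_simps)
      finally show "\<tau> powr (- \<alpha>) * (\<Sum>j=0..k. bw \<alpha> (k - j) * Y j) \<le> (2 * G + 1) * (Y k + Y (k - 1)) + 2 * B" .
      have "\<tau> powr (- \<alpha>) * (\<Sum>j=0..k. bw \<alpha> (k - j) * Z j)
          = \<tau> powr (- \<alpha>) * (\<Sum>j=0..k. bw \<alpha> (k - j) * integral \<Omega> (\<lambda>x. (norm (grad (U j) x))\<^sup>2))
          + \<tau> powr (- \<alpha>) * (\<Sum>j=0..k. bw \<alpha> (k - j) * integral \<Omega> (\<lambda>x. (norm (grad (V j) x))\<^sup>2))"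
        unfolding Z_def by (simp only: distrib_left sum.distrib)
      also have "\<dots> \<le> integral \<Omega> (\<lambda>x. (g1 x)\<^sup>2) / (2 * m1) + integral \<Omega> (\<lambda>x. (g2 x)\<^sup>2) / (2 * m1)"
        by (rule add_mono[OF compU(2) compV(2)])
      also have "\<dots> = (integral \<Omega> (\<lambda>x. (g1 x)\<^sup>2) + integral \<Omega> (\<lambda>x. (g2 x)\<^sup>2)) / (2 * m1)"
        by (rule add_divide_distrib[symmetric])
      also have "\<dots> \<le> (2 * B + 2 * G * (Y k + Y (k - 1))) / (2 * m1)"
        using g GS H1(1) by (intro divide_right_mono) auto
      finally show "\<tau> powr (- \<alpha>) * (\<Sum>j=0..k. bw \<alpha> (k - j) * Z j) \<le> (2 * B + 2 * G * (Y k + Y (k - 1))) / (2 * m1)" .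
    qed
    have time: "exp (b * (real j * \<tau>)) \<le> exp (b * T)" if "j \<le> N" "0 < b" for b j
    proof -
      have "real j * \<tau> \<le> real N * \<tau>"
        using that(1) \<tau> by (intro mult_right_mono) auto
      also have "\<dots> = T" unfolding \<tau>_def using N by simp
      finally show ?thesis using that(2) by simp
    qed
    have step: "b * \<tau> \<le> 1" if "\<tau>s \<le> 1 / b" "0 < b" for b
      using small that unfolding \<tau>_def[symmetric] by (simp add: field_simps) (metis mult.commute mult_left_mono order_trans less_imp_le)
    have grad0: "grad (\<lambda>x::'a. 0::real) = (\<lambda>x. 0)"
      by (intro ext grad_eqI) simp
    \<comment> \<open>The case \<open>j = 0\<close> is included because the gradient recursion at
      \<open>k = 1\<close> reads \<open>Y (k - 1)\<close>.\<close>
    have YR: "Y j \<le> R" if "j \<le> N" for j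
    proof -
      have "Y j \<le> exp (\<beta> (2 * (2 * G + 1) + 2 * B) * (real j * \<tau>))"
      proof (rule bw_gronwall[OF alpha _ _ \<beta>pos(1) _ \<tau> _ _ est(1) that])
        show "2 * (2 * G + 1) + 2 * B \<le> (\<beta> (2 * (2 * G + 1) + 2 * B) / 2) powr \<alpha>"
          using \<beta>(2) B G by simp
        show "\<beta> (2 * (2 * G + 1) + 2 * B) * \<tau> \<le> 1"
          by (intro step \<beta>pos) (simp add: \<tau>s_def)
        show "Y 0 \<le> 1" by (simp add: Y_def UV0)
      qed (use B G in auto)
      also have "\<dots> \<le> R" unfolding R_def by (rule time[OF that \<beta>pos(1)])
      finally show ?thesis .
    qed
    have ZR: "Z j \<le> R'" if "j \<le> N" for j
    proof -
      have "Z j \<le> exp (\<beta> \<mu> * (real j * \<tau>))"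
      proof (rule bw_gronwall[OF alpha order_refl \<mu> \<beta>pos(2) _ \<tau> _ _ _ that])
        show "2 * 0 + \<mu> \<le> (\<beta> \<mu> / 2) powr \<alpha>"
          using \<beta>(2)[OF \<mu>] by simp
        show "\<beta> \<mu> * \<tau> \<le> 1"
          by (intro step \<beta>pos) (simp add: \<tau>s_def)
        show "Z 0 \<le> 1" by (simp add: Z_def UV0 grad0)
        show "\<tau> powr (- \<alpha>) * (\<Sum>j=0..k. bw \<alpha> (k - j) * Z j) \<le> 0 * (Z k + Z (k - 1)) + \<mu>"
          if k: "1 \<le> k" "k \<le> N" for k
        proof -
          have "G * (Y k + Y (k - 1)) \<le> G * (R + R)"
            using YR[of k] YR[of "k - 1"] k G by (intro mult_left_mono add_mono) auto
          then have "(2 * B + 2 * G * (Y k + Y (k - 1))) / (2 * m1) \<le> \<mu>"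
            unfolding \<mu>_def using H1(1) by (intro divide_right_mono) auto
          then show ?thesis using est(2)[OF k] by simp
        qed
      qed
      also have "\<dots> \<le> R'" unfolding R'_def by (rule time[OF that \<beta>pos(2)])
      finally show ?thesis .
    qed
    show ?thesis
      using YR[OF \<open>n \<le> N\<close>] ZR[OF \<open>n \<le> N\<close>] unfolding Y_def Z_def by blast
  qed
  have sqrt_bound: "sqrt a + sqrt b \<le> 2 * sqrt r" if "0 \<le> a" "0 \<le> b" "a + b \<le> r" for a b r :: real
  proof -
    have "sqrt a \<le> sqrt r" "sqrt b \<le> sqrt r"
      using that by (intro real_sqrt_le_mono; simp)+
    then show ?thesis by linarith
  qed
  have "L2_norm \<Omega> (U n) + L2_norm \<Omega> (V n) \<le> 2 * sqrt R + 2 * sqrt R' \<and>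
      grad_norm \<Omega> (U n) + grad_norm \<Omega> (V n) \<le> 2 * sqrt R + 2 * sqrt R'"
    if mesh: "quasi_uniform_mesh \<sigma> \<Omega> Th" and N: "1 \<le> N" and small: "T / real N \<le> \<tau>s"
      and sol: "solves_scheme \<Omega> Th \<alpha> T N M1 M2 f1 f2 U V" and n: "n \<in> {1..N}" for Th N U V n
  proof -
    have mem: "U n \<in> Xh \<Omega> Th" "V n \<in> Xh \<Omega> Th"
      using sol n unfolding solves_scheme_def Let_def by auto
    have L2: "0 \<le> integral \<Omega> (\<lambda>x. (w x)\<^sup>2)" and gr: "0 \<le> integral \<Omega> (\<lambda>x. (norm (grad w x))\<^sup>2)"
      if "w \<in> Xh \<Omega> Th" for w
    proof -
      show "0 \<le> integral \<Omega> (\<lambda>x. (w x)\<^sup>2)"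
        using that unfolding Xh_def by (intro integral_nonneg int) (auto intro!: continuous_intros)
      show "0 \<le> integral \<Omega> (\<lambda>x. (norm (grad w x))\<^sup>2)"
        using Xh_grad_inner_integrable_on[OF mesh dom(1,3) that that]
        by (intro integral_nonneg) (auto simp: power2_norm_eq_inner)
    qed
    have "n \<le> N" using n by simp
    note bounds = main[OF mesh N small sol this]
    have "0 \<le> sqrt R" "0 \<le> sqrt R'" using R by simp_all
    then show ?thesis
      unfolding L2_norm_def grad_norm_def
      using sqrt_bound[OF L2[OF mem(1)] L2[OF mem(2)] conjunct1[OF bounds]]
        sqrt_bound[OF gr[OF mem(1)] gr[OF mem(2)] conjunct2[OF bounds]]
      by linarith
  qed
  moreover have "0 < 2 * sqrt R + 2 * sqrt R'" using R by (intro add_pos_pos) simp_all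
  ultimately show ?thesis
    using \<tau>s by blast
qed

end
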